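(* Let $K$ be a non-empty compact metric space, and let $M(K)$ be the set of probabilities defined on the Borel subsets of $K$, endowed with the weak-$*$ topology. There is a probability $m$ on $M(K)$ which is invariant under the partial maps $\lambda\mapsto\varphi_*(\lambda)$ defined on weak-$*$ open sets, where $\varphi$ is an isometry of $K$.
   Context: The weak-$*$ topology on $M(K)$ is the one induced from the dual of the space of continuous real functions on $K$; $m$ is a probability on the Borel sets of $M(K)$. An isometry of $K$ is a distance-preserving map from $K$ onto itself, and $\varphi_*(\lambda)$ is the push-forward measure. Invariance means: for every isometry $\varphi$ of $K$, every weak-$*$ open set $U\subseteq M(K)$ and every Borel set $B\subseteq U$, $m(\{\varphi_*(\lambda):\lambda\in B\})=m(B)$. *)

theory Defs
  imports "HOL-Probability.Probability"
begin

definition borel_probs :: "'a::metric_space set \<Rightarrow> 'a measure set" where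
  "borel_probs K = {N. sets N = sets (restrict_space borel K) \<and> prob_space N}"

text \<open>The relative topology on the probabilities of the weak-* topology on the dual of
  \<open>C(K)\<close>, i.e. the coarsest topology making all evaluations at continuous functions
  continuous. Only the values of \<open>f\<close> on \<open>K\<close> matter.\<close>

definition weak_star :: "'a::metric_space set \<Rightarrow> 'a measure topology" where
  "weak_star K = topology_generated_by
     {{N \<in> borel_probs K. integral\<^sup>L N f \<in> U} | (f :: 'a \<Rightarrow> real) U. continuous_on K f \<and> open U}"

lemma topspace_weak_star: "topspace (weak_star K) = borel_probs K"
proof -
  have "borel_probs K \<in> {{N \<in> borel_probs K. integral\<^sup>L N f \<in> U} | (f :: 'a \<Rightarrow> real) U.
      continuous_on K f \<and> open U}"
    by (rule CollectI, rule exI[of _ "\<lambda>_. 0"], rule exI[of _ UNIV]) auto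
  then show ?thesis
    unfolding weak_star_def topology_generated_by_topspace by blast
qed

definition borel_of_topology :: "'b topology \<Rightarrow> 'b measure" where
  "borel_of_topology X = sigma (topspace X) {U. openin X U}"

lemma sets_borel_of_topology:
  "sets (borel_of_topology X) = sigma_sets (topspace X) {U. openin X U}"
  unfolding borel_of_topology_def by (rule sets_measure_of) (auto dest: openin_subset)

definition isometry_of :: "'a::metric_space set \<Rightarrow> ('a \<Rightarrow> 'a) \<Rightarrow> bool" where
  "isometry_of K \<phi> \<longleftrightarrow> \<phi> ` K = K \<and> (\<forall>x\<in>K. \<forall>y\<in>K. dist (\<phi> x) (\<phi> y) = dist x y)"

definition push_forward :: "'a::metric_space set \<Rightarrow> ('a \<Rightarrow> 'a) \<Rightarrow> 'a measure \<Rightarrow> 'a measure" where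
  "push_forward K \<phi> N = distr N (restrict_space borel K) \<phi>"

text \<open>The image of \<open>B\<close> is Borel because \<open>push_forward K \<phi>\<close> is a homeomorphism of
  \<open>weak_star K\<close>; this is part of the condition since \<open>emeasure\<close> is \<open>0\<close> on non-measurable sets.\<close>

definition isometry_invariant :: "'a::metric_space set \<Rightarrow> 'a measure measure \<Rightarrow> bool" where
  "isometry_invariant K m \<longleftrightarrow>
     (\<forall>\<phi> U B. isometry_of K \<phi> \<and> openin (weak_star K) U
        \<and> B \<in> sets (borel_of_topology (weak_star K)) \<and> B \<subseteq> U \<longrightarrow>
        push_forward K \<phi> ` B \<in> sets (borel_of_topology (weak_star K))
        \<and> emeasure m (push_forward K \<phi> ` B) = emeasure m B)"

end

theory Submission
  imports Defs
begin

text \<open>It suffices to find an isometry-invariant probability \<open>\<lambda>\<close> on \<open>K\<close>: the point mass at \<open>\<lambda>\<close> is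
  then a probability on \<open>M(K)\<close> that is invariant, since each \<open>\<phi>\<^sub>*\<close> is a homeomorphism fixing \<open>\<lambda>\<close>.
  To construct \<open>\<lambda>\<close>, let \<open>N(e, A)\<close> be the least number of sets of diameter at most \<open>e\<close> that cover
  \<open>A\<close>. By Tychonoff's theorem the functions \<open>A \<mapsto> N(1/n, A) / N(1/n, K)\<close> have a cluster point,
  which is a finitely subadditive isometry-invariant content, additive on positively separated
  sets. Outer approximation by open sets turns it into a metric outer measure, for which Borel
  sets are measurable; compactness of \<open>K\<close> ensures that \<open>K\<close> keeps mass 1.\<close>

section \<open>Metric outer measures\<close>

lemma ennreal_suminf_tail_le:
  fixes f :: "nat \<Rightarrow> ennreal"
  assumes "(\<Sum>k. f k) < top" "0 < e"
  shows "\<exists>n. (\<Sum>k. f (k + n)) \<le> e"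
proof (cases "e = top")
  case False
  let ?s = "\<Sum>k. f k"
  show ?thesis
  \<comment> \<open>Subtraction on \<open>ennreal\<close> is truncated, so the strict bound
    \<open>?s - e < ?s\<close> used in the second case fails for \<open>?s = 0\<close>.\<close>
  proof (cases "?s = 0")
    case True
    then have "f k = 0" for k
      by (simp add: suminf_eq_zero_iff)
    then show ?thesis by simp
  next
    case s0: False
    have "?s - e < ?s"
      using assms s0 by (intro ennreal_between) (auto simp: less_top zero_less_iff_neq_zero)
    moreover have "(\<lambda>n. \<Sum>k<n. f k) \<longlonglongrightarrow> ?s"
      by (simp add: summable_LIMSEQ)
    ultimately have "\<forall>\<^sub>F n in sequentially. ?s - e < (\<Sum>k<n. f k)"
      by (simp add: order_tendstoD(1))
    then obtain n where n: "?s - e < (\<Sum>k<n. f k)"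
      by (auto simp: eventually_sequentially)
    have le: "(\<Sum>k<n. f k) \<le> ?s"
      by (rule sum_le_suminf) auto
    have "(\<Sum>k. f (k + n)) + (\<Sum>k<n. f k) = ?s"
      using suminf_offset[of f n] by (simp add: add.commute)
    also have "?s \<le> e + (\<Sum>k<n. f k)"
      using assms(1) less_imp_le[OF n] unfolding ennreal_minus_le_iff by auto
    finally have "(\<Sum>k. f (k + n)) \<le> e"
      using le assms(1) by (metis add.commute ennreal_add_left_cancel_le infinity_ennreal_def leD)
    then show ?thesis ..
  qed
qed auto

lemma outer_measure_space_mono: "outer_measure_space UNIV f \<Longrightarrow> S \<subseteq> T \<Longrightarrow> f S \<le> f T"
  by (auto simp: outer_measure_space_def increasing_def)

lemma outer_measure_space_Un:
  assumes "outer_measure_space UNIV f"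
  shows "f (S \<union> T) \<le> f S + f T"
proof -
  \<comment> \<open>Countable subadditivity speaks of disjoint families only, hence
    \<open>T - S\<close> in place of \<open>T\<close>.\<close>
  have "f (S \<union> (T - S)) \<le> f S + f (T - S)"
    using assms ring_of_sets.countably_subadditive_subadditive[OF ring_of_sets_Pow, of UNIV f]
    unfolding outer_measure_space_def subadditive_def Pow_UNIV by (metis Diff_disjoint UNIV_I)
  also have "\<dots> \<le> f S + f T"
    using assms by (intro add_left_mono outer_measure_space_mono) auto
  finally show ?thesis by simp
qed

text \<open>The first hypothesis makes \<open>d\<close> 1-Lipschitz, so a gap between values of
  \<open>d\<close> is a gap between points. It is meant for the distance to a closed set.\<close>

lemma positively_separated_layers:
  fixes d :: "'a::metric_space \<Rightarrow> real"
  assumes "\<And>x y. d x \<le> d y + dist x y" "d x \<ge> s" "d y \<le> t"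
  shows "s - t \<le> dist x y"
  using assms(1)[of x y] assms(2,3) by linarith

text \<open>Exhaust \<open>A \<inter> G\<close> by the sets \<open>a n\<close> of points at distance
  at least \<open>1 / real (Suc n)\<close> from the complement of \<open>G\<close>. Each is
  positively separated from \<open>A - G\<close>, so \<open>sep\<close> applies to it; what
  \<open>a n\<close> misses is a union of layers whose outer measures are summable, so its measure
  tends to 0.\<close>

lemma metric_outer_measure_open:
  fixes f :: "'a::metric_space set \<Rightarrow> ennreal"
  assumes om: "outer_measure_space UNIV f"
    and sep: "\<And>A B e. 0 < e \<Longrightarrow> (\<And>x y. x \<in> A \<Longrightarrow> y \<in> B \<Longrightarrow> e \<le> dist x y) \<Longrightarrow> f A + f B \<le> f (A \<union> B)"
    and G: "open G"
  shows "f (A \<inter> G) + f (A - G) \<le> f A"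
\<comment> \<open>\<open>infdist\<close> to the empty set is 0 by convention, so
  \<open>G = UNIV\<close> is treated apart. Finiteness of \<open>f A\<close> is what makes the layer
  sum converge.\<close>
proof (cases "G = UNIV \<or> f A = top")
  case True
  with om show ?thesis
    by (auto simp: outer_measure_space_def positive_def)
next
  case False
  then have ne: "- G \<noteq> {}" and fin: "f A < top" by (auto simp: less_top)
  note mono = outer_measure_space_mono[OF om]
  have csub: "f (\<Union>i. S i) \<le> (\<Sum>i. f (S i))" if "disjoint_family S" for S :: "nat \<Rightarrow> 'a set"
    using om that by (auto simp: outer_measure_space_def countably_subadditive_def)
  define d where "d x = infdist x (- G)" for x
  have tri: "d x \<le> d y + dist x y" for x y
    unfolding d_def by (rule infdist_triangle)
  define a where "a n = {x \<in> A \<inter> G. 1 / real (Suc n) \<le> d x}" for n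
  define r where "r n = a (Suc n) - a n" for n
  have a_mono: "a m \<subseteq> a n" if "m \<le> n" for m n
  proof -
    have "1 / real (Suc n) \<le> 1 / real (Suc m)"
      using that by (simp add: field_simps)
    then show ?thesis by (auto simp: a_def)
  qed
  \<comment> \<open>Skipping the layer \<open>r m\<close> creates the gap: \<open>d\<close> is at
    least \<open>1 / real (Suc m)\<close> on \<open>a m\<close>, but below
    \<open>1 / real (Suc (Suc m))\<close> on \<open>r (Suc m)\<close>, which avoids
    \<open>a (Suc m)\<close>.\<close>
  have step: "f (a m) + f (r (Suc m)) \<le> f (a (Suc (Suc m)))" for m
  proof -
    have "f (a m) + f (r (Suc m)) \<le> f (a m \<union> r (Suc m))"
    proof (rule sep)
      show "0 < 1 / real (Suc m) - 1 / real (Suc (Suc m))"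
        by (simp add: frac_less2)
    next
      fix x y assume "x \<in> a m" "y \<in> r (Suc m)"
      then show "1 / real (Suc m) - 1 / real (Suc (Suc m)) \<le> dist x y"
        by (intro positively_separated_layers[OF tri]) (auto simp: a_def r_def)
    qed
    also have "\<dots> \<le> f (a (Suc (Suc m)))"
      using a_mono[of m "Suc (Suc m)"] by (intro mono) (auto simp: r_def)
    finally show ?thesis .
  qed
  have fa: "f (a n) \<le> f A" for n
    by (intro mono) (auto simp: a_def)
  \<comment> \<open>By \<open>step\<close> each layer costs at most the growth of \<open>f (a n)\<close> over two steps, so no
    splitting into even and odd layers is needed.\<close>
  have telescope: "(\<Sum>k<n. f (r (Suc k))) + f (a 0) + f (a 1) \<le> f (a n) + f (a (Suc n))" for n
  proof (induction n)
    case (Suc n)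
    have "(\<Sum>k<Suc n. f (r (Suc k))) + f (a 0) + f (a 1)
        = ((\<Sum>k<n. f (r (Suc k))) + f (a 0) + f (a 1)) + f (r (Suc n))"
      by (simp add: ac_simps)
    also have "\<dots> \<le> (f (a n) + f (a (Suc n))) + f (r (Suc n))"
      by (intro add_right_mono Suc)
    also have "\<dots> = f (a (Suc n)) + (f (a n) + f (r (Suc n)))"
      by (simp add: ac_simps)
    also have "\<dots> \<le> f (a (Suc n)) + f (a (Suc (Suc n)))"
      by (intro add_left_mono step)
    finally show ?case .
  qed simp
  have "(\<Sum>k. f (r (Suc k))) \<le> f A + f A"
  proof (rule suminf_le_const)
    fix n
    have "(\<Sum>k<n. f (r (Suc k))) \<le> (\<Sum>k<n. f (r (Suc k))) + (f (a 0) + f (a 1))"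
      by simp
    also have "\<dots> \<le> f (a n) + f (a (Suc n))"
      using telescope[of n] by (simp add: add.assoc)
    also have "\<dots> \<le> f A + f A"
      by (intro add_mono fa)
    finally show "(\<Sum>k<n. f (r (Suc k))) \<le> f A + f A" .
  qed simp
  also have "\<dots> < top" using fin by simp
  finally have sum_fin: "(\<Sum>k. f (r (Suc k))) < top" .
  show ?thesis
  proof (rule ennreal_le_epsilon)
    fix e :: real assume "0 < e"
    then obtain n where n: "(\<Sum>k. f (r (Suc (k + n)))) \<le> e"
      using ennreal_suminf_tail_le[OF sum_fin, of "ennreal e"] by auto
    have disj: "disjoint_family (\<lambda>k. r (Suc (k + n)))"
    proof -
      have *: "r i \<inter> r j = {}" if "i < j" for i j
        using a_mono[of "Suc i" j] that by (auto simp: r_def)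
      show ?thesis
        unfolding disjoint_family_on_def
      proof (intro ballI impI)
        fix i j :: nat assume "i \<noteq> j"
        then show "r (Suc (i + n)) \<inter> r (Suc (j + n)) = {}"
          using *[of "Suc (i + n)" "Suc (j + n)"] *[of "Suc (j + n)" "Suc (i + n)"]
          by (cases "i < j") auto
      qed
    qed
    \<comment> \<open>Since \<open>G\<close> is open, \<open>0 < d x\<close> and \<open>x\<close>
      lies in some \<open>a k\<close>; the least such \<open>k\<close> identifies the layer through
      which \<open>x\<close> enters.\<close>
    have "A \<inter> G \<subseteq> a (Suc n) \<union> (\<Union>k. r (Suc (k + n)))"
    proof
      fix x assume x: "x \<in> A \<inter> G"
      then have "0 < d x"
        unfolding d_def using G ne by (metis ComplD IntD2 closed_Compl in_closed_iff_infdist_zero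
            infdist_nonneg order_le_imp_less_or_eq)
      then obtain k where "1 / real (Suc k) < d x"
        using nat_approx_posE by blast
      then have ex: "\<exists>k. x \<in> a k" using x by (auto simp: a_def intro!: exI[of _ k])
      define k where "k = (LEAST k. x \<in> a k)"
      have k: "x \<in> a k" and least: "\<And>j. j < k \<Longrightarrow> x \<notin> a j"
        using LeastI_ex[OF ex] not_less_Least unfolding k_def by blast+
      show "x \<in> a (Suc n) \<union> (\<Union>k. r (Suc (k + n)))"
      proof (cases "k \<le> Suc n")
        case True
        then show ?thesis using a_mono k by blast
      next
        case False
        then obtain j where j: "k = Suc (Suc (j + n))"
          by (metis add.commute add_Suc_right less_iff_Suc_add not_le)
        then have "x \<in> r (Suc (j + n))"
          using k least[of "Suc (j + n)"] by (auto simp: r_def)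
        then show ?thesis by blast
      qed
    qed
    then have "f (A \<inter> G) \<le> f (a (Suc n) \<union> (\<Union>k. r (Suc (k + n))))"
      by (rule mono)
    also have "\<dots> \<le> f (a (Suc n)) + f (\<Union>k. r (Suc (k + n)))"
      by (rule outer_measure_space_Un[OF om])
    also have "\<dots> \<le> f (a (Suc n)) + e"
      using csub[OF disj] n by (intro add_left_mono) (rule order_trans)
    finally have 1: "f (A \<inter> G) \<le> f (a (Suc n)) + e" .
    have "f (a (Suc n)) + f (A - G) \<le> f (a (Suc n) \<union> (A - G))"
    proof (rule sep)
      show "0 < 1 / real (Suc (Suc n))" by simp
      fix x y assume "x \<in> a (Suc n)" "y \<in> A - G"
      then show "1 / real (Suc (Suc n)) \<le> dist x y"
        using infdist_le[of y "- G" x] by (auto simp: a_def d_def)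
    qed
    also have "\<dots> \<le> f A"
      by (intro mono) (auto simp: a_def)
    finally have 2: "f (a (Suc n)) + f (A - G) \<le> f A" .
    have "f (A \<inter> G) + f (A - G) \<le> (f (a (Suc n)) + e) + f (A - G)"
      by (intro add_right_mono 1)
    also have "\<dots> = (f (a (Suc n)) + f (A - G)) + e"
      by (simp add: ac_simps)
    also have "\<dots> \<le> f A + e"
      by (intro add_right_mono 2)
    finally show "f (A \<inter> G) + f (A - G) \<le> f A + e" .
  qed
qed

text \<open>By Caratheodory, \<open>f\<close> is a measure on the sigma-algebra of sets that split
  every set additively. It contains the open sets, hence the Borel sets, to which \<open>f\<close>
  is then restricted.\<close>

lemma metric_outer_measure_borel:
  fixes f :: "'a::metric_space set \<Rightarrow> ennreal"
  assumes om: "outer_measure_space UNIV f"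
    and sep: "\<And>A B e. 0 < e \<Longrightarrow> (\<And>x y. x \<in> A \<Longrightarrow> y \<in> B \<Longrightarrow> e \<le> dist x y) \<Longrightarrow> f A + f B \<le> f (A \<union> B)"
  shows "measure_space UNIV (sets borel) f"
proof -
  interpret P: sigma_algebra "UNIV :: 'a set" UNIV
    using sigma_algebra_Pow[of "UNIV :: 'a set"] by (simp add: Pow_UNIV)
  have ms: "measure_space UNIV (lambda_system UNIV UNIV f) f"
    by (rule P.caratheodory_lemma[OF om])
  have "{G. open G} \<subseteq> lambda_system UNIV UNIV f"
  proof
    fix G :: "'a set" assume "G \<in> {G. open G}"
    then have "open G" by simp
    have "f (A \<inter> G) + f (A - G) = f A" for A
    proof (rule antisym)
      show "f (A \<inter> G) + f (A - G) \<le> f A"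
        by (rule metric_outer_measure_open[OF om sep \<open>open G\<close>])
      show "f A \<le> f (A \<inter> G) + f (A - G)"
        using outer_measure_space_Un[OF om, of "A \<inter> G" "A - G"] by (simp add: Int_Diff_Un)
    qed
    then show "G \<in> lambda_system UNIV UNIV f"
      by (simp add: P.lambda_system_eq)
  qed
  then have "sets borel \<subseteq> lambda_system UNIV UNIV f"
    using ms unfolding borel_def
    by (auto simp: measure_space_def dest: sigma_algebra.sigma_sets_subset)
  with ms show ?thesis
    using sets.sigma_algebra_axioms[of "borel :: 'a measure"] by (simp add: measure_down)
qed

section \<open>Covering numbers\<close>

text \<open>The members are arbitrary sets rather than balls, so preimages of covers under isometric
  maps are again covers.\<close>

definition small_cover :: "real \<Rightarrow> 'a::metric_space set \<Rightarrow> 'a set set \<Rightarrow> bool" where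
  "small_cover e A F \<longleftrightarrow> finite F \<and> A \<subseteq> \<Union>F \<and> (\<forall>S\<in>F. \<forall>x\<in>S. \<forall>y\<in>S. dist x y \<le> e)"

text \<open>\<open>LEAST\<close> is meaningful only if a finite cover exists; the
  \<open>small_cover\<close> hypotheses below provide one, and total boundedness of \<open>K\<close>
  supplies it in the end.\<close>

definition covering_number :: "real \<Rightarrow> 'a::metric_space set \<Rightarrow> nat" where
  "covering_number e A = (LEAST n. \<exists>F. small_cover e A F \<and> card F = n)"

lemma covering_number_le: "small_cover e A F \<Longrightarrow> covering_number e A \<le> card F"
  unfolding covering_number_def by (rule Least_le) blast

lemma covering_number_attained:
  assumes "small_cover e A F"
  obtains F' where "small_cover e A F'" "card F' = covering_number e A"
proof -
  have "\<exists>F'. small_cover e A F' \<and> card F' = covering_number e A"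
    unfolding covering_number_def by (rule LeastI_ex) (use assms in blast)
  then show ?thesis using that by blast
qed

lemma small_cover_subset: "small_cover e B F \<Longrightarrow> A \<subseteq> B \<Longrightarrow> small_cover e A F"
  by (auto simp: small_cover_def)

lemma compact_small_cover:
  assumes "compact K" "0 < e"
  shows "\<exists>F. small_cover e K F"
proof -
  obtain k where k: "finite k" "K \<subseteq> (\<Union>x\<in>k. ball x (e / 2))"
    using assms unfolding compact_eq_totally_bounded by (meson half_gt_zero)
  have "dist x y \<le> e" if "x \<in> ball z (e / 2)" "y \<in> ball z (e / 2)" for x y z
    using that dist_triangle2[of x y z] by (simp add: dist_commute)
  with k have "small_cover e K ((\<lambda>x. ball x (e / 2)) ` k)"
    by (auto simp: small_cover_def)
  then show ?thesis ..
qed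

lemma covering_number_mono:
  assumes "small_cover e B F" "A \<subseteq> B"
  shows "covering_number e A \<le> covering_number e B"
  using assms by (metis covering_number_attained covering_number_le small_cover_subset)

lemma covering_number_Un:
  assumes "small_cover e A F" "small_cover e B G"
  shows "covering_number e (A \<union> B) \<le> covering_number e A + covering_number e B"
proof -
  obtain F' G' where *: "small_cover e A F'" "card F' = covering_number e A"
    "small_cover e B G'" "card G' = covering_number e B"
    using assms by (metis covering_number_attained)
  then have "small_cover e (A \<union> B) (F' \<union> G')"
    by (auto simp: small_cover_def)
  then have "covering_number e (A \<union> B) \<le> card (F' \<union> G')"
    by (rule covering_number_le)
  also have "\<dots> \<le> card F' + card G'"
    by (rule card_Un_le)
  finally show ?thesis using * by simp
qed

text \<open>A set of diameter at most \<open>e\<close> cannot meet both \<open>A\<close> and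
  \<open>B\<close>. Hence the members of an optimal cover of the union that meet \<open>A\<close>
  and those that meet \<open>B\<close> form disjoint families.\<close>

lemma covering_number_separated:
  assumes "small_cover e (A \<union> B) F" and sep: "\<And>x y. x \<in> A \<Longrightarrow> y \<in> B \<Longrightarrow> e < dist x y"
  shows "covering_number e A + covering_number e B \<le> covering_number e (A \<union> B)"
proof -
  obtain F' where F': "small_cover e (A \<union> B) F'" "card F' = covering_number e (A \<union> B)"
    using assms(1) by (rule covering_number_attained)
  define FA FB where "FA = {S \<in> F'. S \<inter> A \<noteq> {}}" and "FB = {S \<in> F'. S \<inter> B \<noteq> {}}"
  have "FA \<inter> FB = {}"
  proof (rule ccontr)
    assume "FA \<inter> FB \<noteq> {}"
    then obtain S x y where "S \<in> F'" "x \<in> S" "x \<in> A" "y \<in> S" "y \<in> B"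
      by (auto simp: FA_def FB_def)
    with F'(1) sep[of x y] show False
      by (auto simp: small_cover_def not_le[symmetric])
  qed
  moreover have fin: "finite F'" "finite FA" "finite FB"
    using F'(1) by (auto simp: FA_def FB_def small_cover_def)
  ultimately have "card FA + card FB = card (FA \<union> FB)"
    by (simp add: card_Un_disjoint)
  also have "\<dots> \<le> card F'"
    using fin by (intro card_mono) (auto simp: FA_def FB_def)
  finally have "card FA + card FB \<le> card F'" .
  moreover have "small_cover e A FA" "small_cover e B FB"
    using F'(1) fin by (simp_all add: FA_def FB_def small_cover_def) blast+
  ultimately show ?thesis
    using F'(2) covering_number_le[of e A FA] covering_number_le[of e B FB] by linarith
qed

lemma covering_number_pos:
  assumes "small_cover e A F" "A \<noteq> {}"
  shows "0 < covering_number e A"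
proof (rule ccontr)
  assume "\<not> 0 < covering_number e A"
  then obtain F' where "small_cover e A F'" "card F' = 0"
    using assms by (metis covering_number_attained not_gr_zero)
  then show False using \<open>A \<noteq> {}\<close> by (auto simp: small_cover_def)
qed

text \<open>The traces on \<open>K\<close> of the preimages of an optimal cover still have diameter
  at most \<open>e\<close>; some of them may coincide, which only lowers the count.\<close>

lemma covering_number_vimage:
  assumes "small_cover e A F" and "\<And>x y. x \<in> K \<Longrightarrow> y \<in> K \<Longrightarrow> dist (\<phi> x) (\<phi> y) = dist x y"
  shows "covering_number e (\<phi> -` A \<inter> K) \<le> covering_number e A"
proof -
  obtain F' where F': "small_cover e A F'" "card F' = covering_number e A"
    using assms(1) by (rule covering_number_attained)
  have "small_cover e (\<phi> -` A \<inter> K) ((\<lambda>S. \<phi> -` S \<inter> K) ` F')"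
    using F'(1) assms(2) by (fastforce simp: small_cover_def)
  then have "covering_number e (\<phi> -` A \<inter> K) \<le> card ((\<lambda>S. \<phi> -` S \<inter> K) ` F')"
    by (rule covering_number_le)
  also have "\<dots> \<le> card F'"
    using F'(1) by (intro card_image_le) (auto simp: small_cover_def)
  finally show ?thesis using F'(2) by simp
qed

section \<open>Invariant contents\<close>

text \<open>Each axiom on \<open>c\<close> compares finitely many of its values by an equation or a
  non-strict inequality, so it survives passage to a cluster point. \<open>mono\<close> makes
  \<open>c\<close> depend on the trace on \<open>K\<close> only. \<open>vimage\<close> is one-sided;
  equality is recovered once there is a probability measure.\<close>

locale isometry_content =
  fixes K :: "'a::metric_space set" and c :: "'a set \<Rightarrow> real"
  assumes compact: "compact K"
    and nonneg: "0 \<le> c A"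
    and empty: "c {} = 0"
    and whole: "c K = 1"
    and mono: "A \<inter> K \<subseteq> B \<Longrightarrow> c A \<le> c B"
    and Un: "c (A \<union> B) \<le> c A + c B"
    and sep: "0 < e \<Longrightarrow> (\<And>x y. x \<in> A \<Longrightarrow> y \<in> B \<Longrightarrow> e \<le> dist x y) \<Longrightarrow> c A + c B \<le> c (A \<union> B)"
    and vimage: "\<phi> ` K \<subseteq> K \<Longrightarrow> (\<And>x y. x \<in> K \<Longrightarrow> y \<in> K \<Longrightarrow> dist (\<phi> x) (\<phi> y) = dist x y)
      \<Longrightarrow> c (\<phi> -` A \<inter> K) \<le> c A"

text \<open>If a closed condition failed at a cluster point, its complement would be a neighbourhood
  that the sequence eventually avoids. Filters replace subsequences because a compact product over
  all sets need not be sequentially compact.\<close>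

lemma compact_sequence_cluster_point:
  fixes X :: "nat \<Rightarrow> 'a::topological_space"
  assumes "compact U" "\<And>n. X n \<in> U"
  obtains c where "\<And>P. closed {x. P x} \<Longrightarrow> (\<forall>\<^sub>F n in sequentially. P (X n)) \<Longrightarrow> P c"
proof -
  let ?F = "filtermap X sequentially"
  have "?F \<noteq> bot" "eventually (\<lambda>x. x \<in> U) ?F"
    using assms(2) by (auto simp: filtermap_bot_iff eventually_filtermap)
  then obtain c where c: "inf (nhds c) ?F \<noteq> bot"
    using assms(1) unfolding compact_filter by blast
  have "P c" if "closed {x. P x}" "\<forall>\<^sub>F n in sequentially. P (X n)" for P
  proof (rule ccontr)
    assume "\<not> P c"
    then have "\<forall>\<^sub>F x in nhds c. x \<in> - {x. P x}"
      using that(1) by (intro eventually_nhds_in_open) auto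
    moreover have "eventually P ?F"
      using that(2) by (simp add: eventually_filtermap)
    ultimately have "\<forall>\<^sub>F x in inf (nhds c) ?F. False"
      unfolding eventually_inf by fastforce
    with c show False by (simp add: eventually_False)
  qed
  then show ?thesis by (rule that)
qed

lemma isometry_content_exists:
  fixes K :: "'a::metric_space set"
  assumes "compact K" "K \<noteq> {}"
  shows "\<exists>c. isometry_content K c"
proof -
  define e where "e n = 1 / real (Suc n)" for n
  define N where "N n A = real (covering_number (e n) (A \<inter> K))" for n and A :: "'a set"
  define X where "X n A = N n A / N n K" for n and A :: "'a set"
  have e: "0 < e n" for n by (simp add: e_def)
  obtain F where FK: "\<And>n. small_cover (e n) K (F n)"
    using compact_small_cover[OF assms(1) e] by metis
  have F: "small_cover (e n) (A \<inter> K) (F n)" for A n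
    by (rule small_cover_subset[OF FK]) auto
  have pos: "0 < N n K" for n
    using covering_number_pos[OF F[of n K]] assms(2) by (simp add: N_def)
  have N_mono: "N n A \<le> N n B" if "A \<inter> K \<subseteq> B" for n A B
    using covering_number_mono[OF F[of n B], of "A \<inter> K"] that by (simp add: N_def)
  have scale: "x / N n K \<le> y / N n K" if "x \<le> y" for n x y
    using that pos[of n] by (intro divide_right_mono) auto
  \<comment> \<open>Monotonicity bounds each ratio by 1, so all \<open>X n\<close> lie in one cube,
    which is compact by Tychonoff's theorem.\<close>
  have X01: "X n \<in> PiE UNIV (\<lambda>_. {0..1})" for n
    using pos[of n] N_mono[of _ K n] by (auto simp: X_def N_def divide_le_eq)
  have "compactin (product_topology (\<lambda>_. euclidean) UNIV) (PiE (UNIV :: 'a set set) (\<lambda>_. {0..1::real}))"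
    by (simp add: compactin_PiE compactin_euclidean_iff)
  then have "compact (PiE (UNIV :: 'a set set) (\<lambda>_. {0..1::real}))"
    by (simp add: euclidean_product_topology compactin_euclidean_iff)
  then obtain c where c: "\<And>P. closed {x. P x} \<Longrightarrow> (\<forall>\<^sub>F n in sequentially. P (X n)) \<Longrightarrow> P c"
    using compact_sequence_cluster_point[of _ X] X01 by metis
  \<comment> \<open>Evaluations are continuous in the product topology, so each axiom defines a
    closed set of functions.\<close>
  have coord: "continuous_on UNIV (\<lambda>f. f A)" for A :: "'a set"
    by simp
  note closed = closed_Collect_le closed_Collect_eq continuous_on_const coord continuous_on_add
  have "isometry_content K c"
  proof
    show "compact K" by fact
    show "0 \<le> c A" for A
      by (rule c[of "\<lambda>f. 0 \<le> f A"]) (auto intro!: closed simp: X_def N_def)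
    show "c {} = 0"
    proof (rule c[of "\<lambda>f. f {} = 0"])
      have "small_cover (e n) ({} :: 'a set) {}" for n
        by (simp add: small_cover_def)
      then have "X n {} = 0" for n
        using covering_number_le[of "e n" "{} :: 'a set" "{}"] by (simp add: X_def N_def)
      then show "\<forall>\<^sub>F n in sequentially. X n {} = 0"
        by simp
    qed (intro closed)
    show "c K = 1"
    proof (rule c[of "\<lambda>f. f K = 1"])
      show "\<forall>\<^sub>F n in sequentially. X n K = 1"
        using pos by (simp add: X_def less_imp_neq[symmetric])
    qed (intro closed)
    show "c A \<le> c B" if "A \<inter> K \<subseteq> B" for A B
    proof (rule c[of "\<lambda>f. f A \<le> f B"])
      show "\<forall>\<^sub>F n in sequentially. X n A \<le> X n B"
        using N_mono[OF that] scale by (simp add: X_def)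
    qed (intro closed)
    show "c (A \<union> B) \<le> c A + c B" for A B
    proof (rule c[of "\<lambda>f. f (A \<union> B) \<le> f A + f B"])
      have "N n (A \<union> B) \<le> N n A + N n B" for n
        using covering_number_Un[OF F[of n A] F[of n B]]
        by (simp add: N_def Int_Un_distrib2 flip: of_nat_add)
      then show "\<forall>\<^sub>F n in sequentially. X n (A \<union> B) \<le> X n A + X n B"
        using scale by (simp add: X_def flip: add_divide_distrib)
    qed (intro closed)
    show "c A + c B \<le> c (A \<union> B)"
      if "0 < \<delta>" and d: "\<And>x y. x \<in> A \<Longrightarrow> y \<in> B \<Longrightarrow> \<delta> \<le> dist x y" for \<delta> A B
    proof (rule c[of "\<lambda>f. f A + f B \<le> f (A \<union> B)"])
      \<comment> \<open>Sets at distance at least \<open>\<delta>\<close> are known to be separated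
        at scale \<open>e n\<close> only once \<open>e n < \<delta>\<close>; this axiom is therefore
        obtained for large \<open>n\<close>.\<close>
      have "e \<longlonglongrightarrow> 0"
        unfolding e_def by (rule LIMSEQ_inverse_real_of_nat[unfolded inverse_eq_divide])
      then have "\<forall>\<^sub>F n in sequentially. e n < \<delta>"
        using \<open>0 < \<delta>\<close> by (rule order_tendstoD)
      then show "\<forall>\<^sub>F n in sequentially. X n A + X n B \<le> X n (A \<union> B)"
      proof eventually_elim
        case (elim n)
        have "N n A + N n B \<le> N n (A \<union> B)"
          using covering_number_separated[of "e n" "A \<inter> K" "B \<inter> K" "F n"] F[of n "A \<union> B"] elim d
          by (fastforce simp: N_def Int_Un_distrib2 simp flip: of_nat_add)
        then show ?case
          using scale by (simp add: X_def flip: add_divide_distrib)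
      qed
    qed (intro closed)
    show "c (\<phi> -` A \<inter> K) \<le> c A"
      if "\<phi> ` K \<subseteq> K" and d: "\<And>x y. x \<in> K \<Longrightarrow> y \<in> K \<Longrightarrow> dist (\<phi> x) (\<phi> y) = dist x y" for \<phi> A
    proof (rule c[of "\<lambda>f. f (\<phi> -` A \<inter> K) \<le> f A"])
      have "\<phi> -` (A \<inter> K) \<inter> K = \<phi> -` A \<inter> K \<inter> K"
        using that(1) by auto
      then have "N n (\<phi> -` A \<inter> K) \<le> N n A" for n
        using covering_number_vimage[OF F[of n A], where K = K and \<phi> = \<phi>] d by (simp add: N_def)
      then show "\<forall>\<^sub>F n in sequentially. X n (\<phi> -` A \<inter> K) \<le> X n A"
        using scale by (simp add: X_def)
    qed (intro closed)
  qed
  then show ?thesis by blast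
qed

section \<open>From the content to a metric outer measure\<close>

context isometry_content
begin

text \<open>\<open>c\<close> need not be countably subadditive: a countable dense set may have
  content 1 while its points have content 0. With open sets, compactness reduces countable covers of
  \<open>K\<close> to finite ones.\<close>

definition outer_content :: "'a set \<Rightarrow> ennreal" where
  "outer_content A = (INF U\<in>{U. open U \<and> A \<inter> K \<subseteq> U}. ennreal (c U))"

text \<open>The name recalls the construction of Haar measure from ratios of covering
  numbers.\<close>

definition haar :: "'a set \<Rightarrow> ennreal" where
  "haar = outer_measure UNIV outer_content"

lemma outer_content_le: "open U \<Longrightarrow> A \<inter> K \<subseteq> U \<Longrightarrow> outer_content A \<le> c U"
  unfolding outer_content_def by (intro INF_lower) auto

lemma outer_content_mono: "A \<inter> K \<subseteq> B \<Longrightarrow> outer_content A \<le> outer_content B"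
  unfolding outer_content_def by (intro INF_superset_mono) auto

lemma positive_outer_content: "positive UNIV outer_content"
  using outer_content_le[of "{}" "{}"] by (simp add: positive_def empty)

lemma increasing_outer_content: "increasing UNIV outer_content"
  unfolding increasing_def by (intro ballI impI outer_content_mono) auto

lemma ring_of_sets_UNIV: "ring_of_sets (UNIV :: 'a set) UNIV"
  using ring_of_sets_Pow[of "UNIV :: 'a set"] by simp

lemma outer_measure_space_haar: "outer_measure_space UNIV haar"
  using ring_of_sets.outer_measure_space_outer_measure[OF ring_of_sets_UNIV
      positive_outer_content increasing_outer_content]
  by (simp add: haar_def)

lemma haar_le: "A \<subseteq> (\<Union>i. D i) \<Longrightarrow> haar A \<le> (\<Sum>i. outer_content (D i))"
  unfolding haar_def
  by (rule ring_of_sets.outer_measure_le[OF ring_of_sets_UNIV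
      positive_outer_content increasing_outer_content]) auto

lemma haar_le_outer_content: "haar A \<le> outer_content A"
proof -
  have "haar A \<le> (\<Sum>i. outer_content (if i = 0 then A else {}))"
    by (rule haar_le) auto
  also have "\<dots> = outer_content A"
    using positive_outer_content by (subst suminf_finite[of "{0}"]) (auto simp: positive_def)
  finally show ?thesis .
qed

lemma haar_greatest:
  "(\<And>D. A \<subseteq> (\<Union>i. D i) \<Longrightarrow> x \<le> (\<Sum>i. outer_content (D i))) \<Longrightarrow> x \<le> haar A"
  unfolding haar_def outer_measure_def by (intro INF_greatest) auto

text \<open>Thickening \<open>A\<close> and \<open>B\<close> by \<open>e / 3\<close> gives open sets
  that are still \<open>e / 3\<close> apart, so \<open>sep\<close> applies to their intersections
  with any open \<open>U\<close> around the trace of \<open>D\<close>. The set \<open>D\<close> is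
  there for summation over the members of a cover.\<close>

lemma outer_content_separated:
  assumes "0 < e" "\<And>x y. x \<in> A \<Longrightarrow> y \<in> B \<Longrightarrow> e \<le> dist x y"
  shows "outer_content (D \<inter> A) + outer_content (D \<inter> B) \<le> outer_content D"
  unfolding outer_content_def[of D]
proof (rule INF_greatest)
  fix U assume U: "U \<in> {U. open U \<and> D \<inter> K \<subseteq> U}"
  define nbhd where "nbhd S = (\<Union>x\<in>S. ball x (e / 3))" for S :: "'a set"
  have nbhd: "open (nbhd S)" "S \<subseteq> nbhd S" for S
    using \<open>0 < e\<close> by (force simp: nbhd_def)+
  have far: "e / 3 \<le> dist x y" if xy: "x \<in> nbhd A" "y \<in> nbhd B" for x y
  proof -
    obtain a where a: "a \<in> A" "x \<in> ball a (e / 3)"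
      using xy(1) unfolding nbhd_def by blast
    obtain b where b: "b \<in> B" "y \<in> ball b (e / 3)"
      using xy(2) unfolding nbhd_def by blast
    have "dist a x < e / 3" "dist b y < e / 3"
      using a(2) b(2) by (simp_all only: mem_ball)
    moreover have "dist a b \<le> dist a x + dist x y + dist b y"
      using dist_triangle[of a b x] dist_triangle[of x b y] by (simp add: dist_commute)
    ultimately show ?thesis using assms(2)[OF a(1) b(1)] by linarith
  qed
  have "outer_content (D \<inter> A) + outer_content (D \<inter> B)
      \<le> ennreal (c (U \<inter> nbhd A)) + ennreal (c (U \<inter> nbhd B))"
    using U nbhd by (intro add_mono outer_content_le) auto
  also have "\<dots> = ennreal (c (U \<inter> nbhd A) + c (U \<inter> nbhd B))"
    by (simp add: nonneg)
  also have "\<dots> \<le> ennreal (c ((U \<inter> nbhd A) \<union> (U \<inter> nbhd B)))"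
    using \<open>0 < e\<close> far by (intro ennreal_leI sep[of "e / 3"]) auto
  also have "\<dots> \<le> ennreal (c U)"
    by (intro ennreal_leI mono) auto
  finally show "outer_content (D \<inter> A) + outer_content (D \<inter> B) \<le> ennreal (c U)" .
qed

text \<open>Every countable cover of the union splits member by member into a cover of
  \<open>A\<close> and one of \<open>B\<close>.\<close>

lemma haar_separated:
  assumes "0 < e" "\<And>x y. x \<in> A \<Longrightarrow> y \<in> B \<Longrightarrow> e \<le> dist x y"
  shows "haar A + haar B \<le> haar (A \<union> B)"
proof (rule haar_greatest)
  fix D :: "nat \<Rightarrow> 'a set" assume D: "A \<union> B \<subseteq> (\<Union>i. D i)"
  have "haar A + haar B \<le> (\<Sum>i. outer_content (D i \<inter> A)) + (\<Sum>i. outer_content (D i \<inter> B))"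
    using D by (intro add_mono haar_le) auto
  also have "\<dots> = (\<Sum>i. outer_content (D i \<inter> A) + outer_content (D i \<inter> B))"
    by (rule suminf_add) auto
  also have "\<dots> \<le> (\<Sum>i. outer_content (D i))"
    by (intro suminf_le outer_content_separated[OF assms]) auto
  finally show "haar A + haar B \<le> (\<Sum>i. outer_content (D i))" .
qed

lemma content_UN: "finite I \<Longrightarrow> c (\<Union>i\<in>I. U i) \<le> (\<Sum>i\<in>I. c (U i))"
proof (induction I rule: finite_induct)
  case (insert i I)
  then show ?case
    using Un[of "U i" "\<Union>i\<in>I. U i"] by simp
qed (simp add: empty)

text \<open>For the lower bound, a countable cover is enlarged to open sets at total extra cost
  \<open>e\<close>; a finite subcover exists by compactness, and finite subadditivity of
  \<open>c\<close> then suffices.\<close>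

lemma haar_whole: "haar K = 1"
proof (rule antisym)
  have "haar K \<le> c UNIV"
    using haar_le_outer_content[of K] outer_content_le[of UNIV K] by (auto intro: order_trans)
  also have "c UNIV = 1"
    using mono[of UNIV K] mono[of K UNIV] whole by simp
  finally show "haar K \<le> 1" by simp
next
  show "1 \<le> haar K"
  proof (rule haar_greatest)
    fix D :: "nat \<Rightarrow> 'a set" assume D: "K \<subseteq> (\<Union>i. D i)"
    show "1 \<le> (\<Sum>i. outer_content (D i))"
    proof (rule ennreal_le_epsilon)
      fix e :: real assume "0 < e" and fin: "(\<Sum>i. outer_content (D i)) < top"
      \<comment> \<open>The exponent starts at 1, so the allowances sum to exactly \<open>e\<close>.
        The strict inequality uses that \<open>outer_content (D i)\<close> is finite, by
        \<open>fin\<close>.\<close>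
      have "\<exists>U. open U \<and> D i \<inter> K \<subseteq> U \<and> ennreal (c U) < outer_content (D i) + e * (1/2) ^ Suc i" for i
      proof -
        have "outer_content (D i) < outer_content (D i) + e * (1/2) ^ Suc i"
          using fin \<open>0 < e\<close> by (auto simp: less_top dest!: ennreal_suminf_lessD)
        then show ?thesis
          unfolding outer_content_def[of "D i"] INF_less_iff by auto
      qed
      then obtain U where U: "\<And>i. open (U i)" "\<And>i. D i \<inter> K \<subseteq> U i"
          "\<And>i. ennreal (c (U i)) < outer_content (D i) + e * (1/2) ^ Suc i"
        by metis
      have "K \<subseteq> (\<Union>i. U i)"
        using D U(2) by blast
      then obtain I where I: "finite I" "K \<subseteq> (\<Union>i\<in>I. U i)"
        using compact U(1) by (metis compactE_image iso_tuple_UNIV_I)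
      have "1 \<le> c (\<Union>i\<in>I. U i)"
        using mono[of K "\<Union>i\<in>I. U i"] I(2) whole by auto
      also have "\<dots> \<le> (\<Sum>i\<in>I. c (U i))"
        by (rule content_UN[OF I(1)])
      finally have "ennreal 1 \<le> ennreal (\<Sum>i\<in>I. c (U i))"
        by (rule ennreal_leI)
      also have "\<dots> = (\<Sum>i\<in>I. ennreal (c (U i)))"
        by (rule sum_ennreal[symmetric]) (rule nonneg)
      also have "\<dots> \<le> (\<Sum>i. ennreal (c (U i)))"
        by (rule sum_le_suminf) (auto simp: I)
      also have "\<dots> \<le> (\<Sum>i. outer_content (D i) + ennreal (e * (1/2) ^ Suc i))"
        by (intro suminf_le less_imp_le U) auto
      also have "\<dots> = (\<Sum>i. outer_content (D i)) + (\<Sum>i. ennreal e * ennreal ((1/2) ^ Suc i))"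
        using \<open>0 < e\<close>
        by (subst suminf_add[symmetric])
           (auto simp del: ennreal_suminf_cmult simp add: ennreal_mult[symmetric])
      also have "\<dots> = (\<Sum>i. outer_content (D i)) + e"
        unfolding ennreal_suminf_cmult
        by (subst suminf_ennreal_eq[OF zero_le_power power_half_series]) auto
      finally show "1 \<le> (\<Sum>i. outer_content (D i)) + e" by simp
    qed
  qed
qed

lemma haar_vimage_le:
  assumes \<phi>: "\<phi> ` K \<subseteq> K" "\<And>x y. x \<in> K \<Longrightarrow> y \<in> K \<Longrightarrow> dist (\<phi> x) (\<phi> y) = dist x y"
  shows "haar (\<phi> -` A \<inter> K) \<le> haar A"
proof (rule haar_greatest)
  fix D :: "nat \<Rightarrow> 'a set" assume D: "A \<subseteq> (\<Union>i. D i)"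
  have cont: "continuous_on K \<phi>"
    unfolding continuous_on_iff using \<phi>(2) by metis
  have le: "outer_content (\<phi> -` S \<inter> K) \<le> outer_content S" for S
    unfolding outer_content_def[of S]
  proof (rule INF_greatest)
    fix U assume U: "U \<in> {U. open U \<and> S \<inter> K \<subseteq> U}"
    \<comment> \<open>The preimage of \<open>U\<close> is open only relative to \<open>K\<close>;
      \<open>V\<close> is an ambient open set with the same trace.\<close>
    then obtain V where V: "open V" "V \<inter> K = \<phi> -` U \<inter> K"
      using cont unfolding continuous_on_open_invariant by blast
    have "\<phi> -` S \<inter> K \<subseteq> \<phi> -` U \<inter> K"
      using U \<phi>(1) by auto
    then have "outer_content (\<phi> -` S \<inter> K) \<le> c V"
      using V by (intro outer_content_le) auto
    also have "\<dots> \<le> c (\<phi> -` U \<inter> K)"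
      using V by (intro ennreal_leI mono) auto
    also have "\<dots> \<le> c U"
      by (intro ennreal_leI vimage \<phi>)
    finally show "outer_content (\<phi> -` S \<inter> K) \<le> c U" .
  qed
  have "haar (\<phi> -` A \<inter> K) \<le> (\<Sum>i. outer_content (\<phi> -` D i \<inter> K))"
    using D by (intro haar_le) blast
  also have "\<dots> \<le> (\<Sum>i. outer_content (D i))"
    by (intro suminf_le le) auto
  finally show "haar (\<phi> -` A \<inter> K) \<le> (\<Sum>i. outer_content (D i))" .
qed

end

section \<open>The invariant measure\<close>

text \<open>Passing to complements reverses the inequality because both total masses are 1. This
  upgrades the one-sided \<open>haar_vimage_le\<close> to invariance.\<close>

lemma prob_space_eqI_le:
  assumes "prob_space M" "prob_space N" "sets M = sets N"
    and le: "\<And>A. A \<in> sets M \<Longrightarrow> emeasure M A \<le> emeasure N A"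
  shows "M = N"
proof (rule measure_eqI)
  fix A assume A: "A \<in> sets M"
  interpret M: prob_space M by fact
  interpret N: prob_space N by fact
  have le': "M.prob S \<le> N.prob S" if "S \<in> sets M" for S
    using le[OF that] by (simp add: M.emeasure_eq_measure N.emeasure_eq_measure)
  have "M.prob (space M - A) \<le> N.prob (space N - A)"
    using le'[of "space M - A"] A sets_eq_imp_space_eq[OF assms(3)] by (metis sets.compl_sets)
  then have "N.prob A \<le> M.prob A"
    using M.prob_compl[OF A] N.prob_compl[of A] A assms(3) by simp
  then show "emeasure M A = emeasure N A"
    using le'[OF A] by (simp add: M.emeasure_eq_measure N.emeasure_eq_measure)
qed fact

lemma isometry_of_measurable:
  assumes "isometry_of K \<phi>"
  shows "\<phi> \<in> measurable (restrict_space borel K) (restrict_space borel K)"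
proof -
  have "continuous_on K \<phi>"
    unfolding continuous_on_iff using assms unfolding isometry_of_def by metis
  then have "\<phi> \<in> borel_measurable (restrict_space borel K)"
    by (rule borel_measurable_continuous_on_restrict)
  then show ?thesis
    using assms by (intro measurable_restrict_space2) (auto simp: isometry_of_def space_restrict_space)
qed

lemma push_forward_borel_probs:
  assumes "isometry_of K \<phi>" "N \<in> borel_probs K"
  shows "push_forward K \<phi> N \<in> borel_probs K"
proof -
  have "\<phi> \<in> measurable N (restrict_space borel K)"
    using isometry_of_measurable[OF assms(1)] assms(2)
    by (simp add: borel_probs_def cong: measurable_cong_sets)
  then show ?thesis
    using assms(2) by (auto simp: borel_probs_def push_forward_def intro: prob_space.prob_space_distr)
qed

lemma invariant_probability_exists:
  fixes K :: "'a::metric_space set"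
  assumes K: "compact K" "K \<noteq> {}"
  shows "\<exists>N\<in>borel_probs K. \<forall>\<phi>. isometry_of K \<phi> \<longrightarrow> push_forward K \<phi> N = N"
proof -
  obtain c where "isometry_content K c"
    using isometry_content_exists[OF K] ..
  then interpret isometry_content K c .
  define L where "L = measure_of UNIV (sets borel) haar"
  have ms: "measure_space UNIV (sets borel) haar"
    by (rule metric_outer_measure_borel[OF outer_measure_space_haar haar_separated])
  have sets_L: "sets L = sets borel"
    unfolding L_def using sets.sigma_sets_eq[of borel] by (simp add: sets_measure_of_conv)
  have L: "emeasure L A = haar A" if "A \<in> sets borel" for A
    unfolding L_def using ms that sets.sigma_algebra_axioms[of "borel :: 'a measure"]
    by (intro emeasure_measure_of_sigma) (auto simp: measure_space_def)
  have "K \<in> sets borel"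
    using K(1) by (simp add: borel_closed compact_imp_closed)
  \<comment> \<open>\<open>L\<close> lives on the whole type, while members of
    \<open>borel_probs K\<close> have space \<open>K\<close>; \<open>haar_whole\<close> gives the
    restriction mass 1.\<close>
  define N where "N = restrict_space L K"
  have sets_N: "sets N = sets (restrict_space borel K)"
    unfolding N_def by (rule sets_restrict_space_cong[OF sets_L])
  have N: "emeasure N A = haar A" if "A \<in> sets N" for A
  proof -
    have "A \<subseteq> K" "A \<in> sets borel"
      using that \<open>K \<in> sets borel\<close> unfolding sets_N by (auto simp: sets_restrict_space_iff)
    then show ?thesis
      unfolding N_def using \<open>K \<in> sets borel\<close> sets_L
      by (subst emeasure_restrict_space) (auto simp: L sets_eq_imp_space_eq[OF sets_L])
  qed
  have space_N: "space N = K"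
    using sets_eq_imp_space_eq[OF sets_N] by (simp add: space_restrict_space)
  have "prob_space N"
    using N[OF sets.top] haar_whole by (intro prob_spaceI) (simp add: space_N)
  then have NK: "N \<in> borel_probs K"
    by (simp add: borel_probs_def sets_N)
  moreover have "push_forward K \<phi> N = N" if \<phi>: "isometry_of K \<phi>" for \<phi>
  proof (rule prob_space_eqI_le)
    show "prob_space (push_forward K \<phi> N)"
      using push_forward_borel_probs[OF \<phi> NK] by (simp add: borel_probs_def)
    show sets_eq: "sets (push_forward K \<phi> N) = sets N"
      by (simp add: push_forward_def sets_N)
    fix A assume "A \<in> sets (push_forward K \<phi> N)"
    then have A: "A \<in> sets N" unfolding sets_eq .
    have meas: "\<phi> \<in> measurable N (restrict_space borel K)"
      using isometry_of_measurable[OF \<phi>] by (simp add: sets_N cong: measurable_cong_sets)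
    then have "\<phi> -` A \<inter> K \<in> sets N"
      using A measurable_sets[of \<phi> N "restrict_space borel K" A] by (simp add: sets_N space_N)
    then have "emeasure (push_forward K \<phi> N) A = haar (\<phi> -` A \<inter> K)"
      using A meas by (simp add: push_forward_def emeasure_distr sets_N space_N N)
    also have "\<dots> \<le> haar A"
      using \<phi> by (intro haar_vimage_le) (auto simp: isometry_of_def)
    finally show "emeasure (push_forward K \<phi> N) A \<le> emeasure N A"
      using A by (simp add: N)
  qed fact
  ultimately show ?thesis by blast
qed

section \<open>Push-forward as a homeomorphism\<close>

text \<open>By change of variables, the preimage of the subbasic set given by \<open>f\<close> and
  \<open>U\<close> is the one given by \<open>f \<circ> \<phi>\<close> and \<open>U\<close>.\<close>

lemma continuous_map_push_forward:
  assumes \<phi>: "isometry_of K \<phi>"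
  shows "continuous_map (weak_star K) (weak_star K) (push_forward K \<phi>)"
proof -
  let ?S = "{{N \<in> borel_probs K. integral\<^sup>L N f \<in> U} | (f :: 'a \<Rightarrow> real) U. continuous_on K f \<and> open U}"
  have "continuous_map (weak_star K) (topology_generated_by ?S) (push_forward K \<phi>)"
  proof (rule continuous_on_generated_topo)
    fix W assume "W \<in> ?S"
    then obtain f :: "'a \<Rightarrow> real" and U
      where W: "W = {N \<in> borel_probs K. integral\<^sup>L N f \<in> U}" "continuous_on K f" "open U"
      by blast
    have \<phi>c: "continuous_on K \<phi>" "\<phi> ` K = K"
      using \<phi> unfolding continuous_on_iff isometry_of_def by metis+
    have "integral\<^sup>L (push_forward K \<phi> N) f = integral\<^sup>L N (f \<circ> \<phi>)" if "N \<in> borel_probs K" for N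
      unfolding push_forward_def comp_def
      using isometry_of_measurable[OF \<phi>] that W(2)
      by (intro integral_distr borel_measurable_continuous_on_restrict)
         (simp_all add: borel_probs_def cong: measurable_cong_sets)
    then have "push_forward K \<phi> -` W \<inter> topspace (weak_star K)
        = {N \<in> borel_probs K. integral\<^sup>L N (f \<circ> \<phi>) \<in> U}"
      using push_forward_borel_probs[OF \<phi>] by (auto simp: W(1) topspace_weak_star)
    moreover have "continuous_on K (f \<circ> \<phi>)"
      using W(2) \<phi>c by (intro continuous_on_compose) simp_all
    then have "{N \<in> borel_probs K. integral\<^sup>L N (f \<circ> \<phi>) \<in> U} \<in> ?S"
      using W(3) by blast
    ultimately show "openin (weak_star K) (push_forward K \<phi> -` W \<inter> topspace (weak_star K))"
      by (simp add: weak_star_def topology_generated_by_Basis)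
  next
    have "\<Union>?S = borel_probs K"
      using topspace_weak_star[of K] unfolding weak_star_def topology_generated_by_topspace .
    then show "push_forward K \<phi> ` topspace (weak_star K) \<subseteq> \<Union>?S"
      using push_forward_borel_probs[OF \<phi>] by (auto simp: topspace_weak_star)
  qed
  then show ?thesis by (simp add: weak_star_def)
qed

lemma space_borel_of_topology: "space (borel_of_topology X) = topspace X"
  unfolding borel_of_topology_def by (rule space_measure_of) (auto dest: openin_subset)

lemma measurable_borel_of_topology:
  assumes "continuous_map X Y f"
  shows "f \<in> measurable (borel_of_topology X) (borel_of_topology Y)"
proof (rule measurable_sigma_sets[OF sets_borel_of_topology])
  show "{U. openin Y U} \<subseteq> Pow (topspace Y)"
    by (auto dest: openin_subset)
  show "f \<in> space (borel_of_topology X) \<rightarrow> topspace Y"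
    using assms by (simp add: space_borel_of_topology continuous_map_def)
  fix U assume "U \<in> {U. openin Y U}"
  then have "openin X (f -` U \<inter> topspace X)"
    using assms by (simp add: continuous_map_alt)
  then show "f -` U \<inter> space (borel_of_topology X) \<in> sets (borel_of_topology X)"
    by (simp add: space_borel_of_topology sets_borel_of_topology sigma_sets.Basic)
qed

lemma isometry_of_inv_into:
  assumes "isometry_of K \<phi>"
  shows "isometry_of K (inv_into K \<phi>)"
    and "\<And>x. x \<in> K \<Longrightarrow> inv_into K \<phi> (\<phi> x) = x" "\<And>x. x \<in> K \<Longrightarrow> \<phi> (inv_into K \<phi> x) = x"
proof -
  have "inj_on \<phi> K"
    using assms unfolding isometry_of_def inj_on_def by (metis dist_eq_0_iff)
  then have "bij_betw \<phi> K K"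
    using assms by (simp add: bij_betw_def isometry_of_def)
  note bij = this bij_betw_inv_into[OF this]
  show "\<And>x. x \<in> K \<Longrightarrow> inv_into K \<phi> (\<phi> x) = x"
    using bij(1) by (rule bij_betw_inv_into_left)
  show right: "\<And>x. x \<in> K \<Longrightarrow> \<phi> (inv_into K \<phi> x) = x"
    using bij(1) by (rule bij_betw_inv_into_right)
  have "dist (inv_into K \<phi> x) (inv_into K \<phi> y) = dist x y" if "x \<in> K" "y \<in> K" for x y
    using assms right[OF that(1)] right[OF that(2)] bij_betwE[OF bij(2)] that
    unfolding isometry_of_def by metis
  then show "isometry_of K (inv_into K \<phi>)"
    using bij_betw_imp_surj_on[OF bij(2)] by (simp add: isometry_of_def)
qed

lemma push_forward_inverse:
  assumes "isometry_of K \<phi>" "isometry_of K \<psi>" "\<And>x. x \<in> K \<Longrightarrow> \<psi> (\<phi> x) = x"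
    and N: "N \<in> borel_probs K"
  shows "push_forward K \<psi> (push_forward K \<phi> N) = N"
proof -
  have sets_N: "sets N = sets (restrict_space borel K)" and space_N: "space N = K"
    using N sets_eq_imp_space_eq[of N "restrict_space borel K"]
    by (auto simp: borel_probs_def space_restrict_space)
  have "\<phi> \<in> measurable N (restrict_space borel K)"
    using isometry_of_measurable[OF assms(1)] by (simp add: sets_N cong: measurable_cong_sets)
  then have "push_forward K \<psi> (push_forward K \<phi> N) = distr N (restrict_space borel K) (\<psi> \<circ> \<phi>)"
    unfolding push_forward_def by (rule distr_distr[OF isometry_of_measurable[OF assms(2)]])
  \<comment> \<open>The composition is the identity on \<open>K\<close>, which is the whole space of
    \<open>N\<close>.\<close>
  also have "\<dots> = distr N N (\<lambda>x. x)"
    using assms(3) by (intro distr_cong) (auto simp: sets_N space_N)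
  finally show ?thesis by simp
qed

theorem theorem18:
  fixes K :: "'a::metric_space set"
  assumes "compact K" and "K \<noteq> {}"
  shows "\<exists>m. sets m = sets (borel_of_topology (weak_star K)) \<and> prob_space m
             \<and> isometry_invariant K m"
proof -
  obtain N where N: "N \<in> borel_probs K"
    and inv: "\<And>\<phi>. isometry_of K \<phi> \<Longrightarrow> push_forward K \<phi> N = N"
    using invariant_probability_exists[OF assms] by blast
  let ?B = "borel_of_topology (weak_star K)"
  define m where "m = return ?B N"
  have space: "space ?B = borel_probs K"
    by (simp add: space_borel_of_topology topspace_weak_star)
  have "isometry_invariant K m"
    unfolding isometry_invariant_def
  proof (intro allI impI)
    fix \<phi> U B
    assume "isometry_of K \<phi> \<and> openin (weak_star K) U \<and> B \<in> sets ?B \<and> B \<subseteq> U"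
    then have \<phi>: "isometry_of K \<phi>" and B: "B \<in> sets ?B" by auto
    define \<psi> where "\<psi> = inv_into K \<phi>"
    have \<psi>: "isometry_of K \<psi>" "\<And>x. x \<in> K \<Longrightarrow> \<psi> (\<phi> x) = x" "\<And>x. x \<in> K \<Longrightarrow> \<phi> (\<psi> x) = x"
      using isometry_of_inv_into[OF \<phi>] by (auto simp: \<psi>_def)
    have sub: "B \<subseteq> borel_probs K"
      using sets.sets_into_space[OF B] by (simp add: space)
    \<comment> \<open>Writing the image as a preimage under the inverse push-forward makes it Borel
      by continuity of the latter.\<close>
    have image: "push_forward K \<phi> ` B = push_forward K \<psi> -` B \<inter> space ?B"
    proof (intro equalityI subsetI)
      fix x assume "x \<in> push_forward K \<phi> ` B"
      then obtain y where "y \<in> B" "x = push_forward K \<phi> y" by blast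
      then show "x \<in> push_forward K \<psi> -` B \<inter> space ?B"
        using sub push_forward_inverse[OF \<phi> \<psi>(1,2), of y] push_forward_borel_probs[OF \<phi>, of y]
        by (auto simp: space)
    next
      fix x assume "x \<in> push_forward K \<psi> -` B \<inter> space ?B"
      then show "x \<in> push_forward K \<phi> ` B"
        using push_forward_inverse[OF \<psi>(1) \<phi> \<psi>(3), of x] by (auto simp: space intro: rev_image_eqI)
    qed
    have meas: "push_forward K \<phi> ` B \<in> sets ?B"
      unfolding image
      by (rule measurable_sets[OF measurable_borel_of_topology[OF continuous_map_push_forward[OF \<psi>(1)]] B])
    \<comment> \<open>A point mass sees only whether \<open>N\<close> belongs to the set, and
      \<open>N\<close> is fixed by \<open>push_forward K \<psi>\<close>.\<close>
    have "N \<in> push_forward K \<phi> ` B \<longleftrightarrow> N \<in> B"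
      using N inv[OF \<psi>(1)] by (auto simp: image space)
    then have "emeasure m (push_forward K \<phi> ` B) = emeasure m B"
      using meas B by (simp add: m_def indicator_def)
    with meas show "push_forward K \<phi> ` B \<in> sets ?B \<and> emeasure m (push_forward K \<phi> ` B) = emeasure m B"
      by blast
  qed
  moreover have "prob_space m"
    unfolding m_def by (rule prob_space_return) (simp add: space N)
  ultimately show ?thesis
    by (intro exI[of _ m]) (simp add: m_def)
qed

end
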